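(* Let $n\ge 6$. Then $w_2=\lfloor (3n-2)/2\rfloor$, and, with $\mathbf{b}_1=\overline{10}[n]$, $\mathbf{b}_2=01\cdot\overline{0}[n-2]$, $\mathbf{b}_3=\overline{0}[n-2]\cdot 11$, $\mathbf{b}_4=\overline{01}[n]$, $\mathbf{b}_5=11\cdot\overline{0}[n-2]$, $\mathbf{b}_6=\overline{0}[n-2]\cdot 10$: (i) if $n=6$, then $W_2=\{\mathbf{b}_1,\ldots,\mathbf{b}_6,001000,000100,001100\}$; (ii) if $n=7$, then $W_2=\{\mathbf{b}_2,\mathbf{b}_4,\mathbf{b}_6,0001000\}$; (iii) if $n\ge 8$ is even, then $W_2=\{\mathbf{b}_1,\mathbf{b}_2,\mathbf{b}_3,\mathbf{b}_4,\mathbf{b}_5,\mathbf{b}_6\}$; (iv) if $n\ge 9$ is odd, then $W_2=\{\mathbf{b}_2,\mathbf{b}_4,\mathbf{b}_6\}$.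
   Context: For $\mathbf{x}=(x_0,\ldots,x_{n-1})\in\mathbb{F}_2^n$, the derivative is $\partial\mathbf{x}=(x_0+x_1,\ldots,x_{n-2}+x_{n-1})\in\mathbb{F}_2^{n-1}$, with $\partial^0\mathbf{x}=\mathbf{x}$ and $\partial^i\mathbf{x}=\partial(\partial^{i-1}\mathbf{x})$. The Steinhaus triangle is $T(\mathbf{x})=(\mathbf{x},\partial\mathbf{x},\ldots,\partial^{n-1}\mathbf{x})$; $|\mathbf{y}|$ is the number of ones of a binary sequence and $|T(\mathbf{x})|=\sum_{i=0}^{n-1}|\partial^i\mathbf{x}|$. For fixed $n$, let $0=w_0<w_1<\cdots<w_m$ be the distinct values of $|T(\mathbf{x})|$ over $\mathbf{x}\in\mathbb{F}_2^n$, and $W_i=\{\mathbf{x}\in\mathbb{F}_2^n:|T(\mathbf{x})|=w_i\}$. Sequences are written as words; a dot denotes concatenation; $\overline{x_1\cdots x_p}[k]$ is the word of the first $k$ letters of the infinite periodic word $x_1\cdots x_px_1\cdots x_p\cdots$. *)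

theory Defs
  imports Main "HOL-Library.Z2"
begin

definition derivative :: "bit list \<Rightarrow> bit list" where
  "derivative x = map (\<lambda>i. x ! i + x ! Suc i) [0..<length x - 1]"

definition steinhaus_triangle :: "bit list \<Rightarrow> bit list list" where
  "steinhaus_triangle x = map (\<lambda>i. (derivative ^^ i) x) [0..<length x]"

definition ones :: "bit list \<Rightarrow> nat" where
  "ones y = count_list y 1"

definition triangle_weight :: "bit list list \<Rightarrow> nat" where
  "triangle_weight t = (\<Sum>y\<leftarrow>t. ones y)"

definition sequences :: "nat \<Rightarrow> bit list set" where
  "sequences n = {x. length x = n}"

definition weights :: "nat \<Rightarrow> nat set" where
  "weights n = (\<lambda>x. triangle_weight (steinhaus_triangle x)) ` sequences n"

text \<open>The distinct weights in increasing order, starting with index 0. The value is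
  meaningful only for \<open>i < card (weights n)\<close>.\<close>

definition w :: "nat \<Rightarrow> nat \<Rightarrow> nat" where
  "w n i = sorted_list_of_set (weights n) ! i"

definition W :: "nat \<Rightarrow> nat \<Rightarrow> bit list set" where
  "W n i = {x \<in> sequences n. triangle_weight (steinhaus_triangle x) = w n i}"

definition periodic_word :: "bit list \<Rightarrow> nat \<Rightarrow> bit list" where
  "periodic_word p k = map (\<lambda>i. p ! (i mod length p)) [0..<k]"

definition b1 :: "nat \<Rightarrow> bit list" where
  "b1 n = periodic_word [1, 0] n"

definition b2 :: "nat \<Rightarrow> bit list" where
  "b2 n = [0, 1] @ periodic_word [0] (n - 2)"

definition b3 :: "nat \<Rightarrow> bit list" where
  "b3 n = periodic_word [0] (n - 2) @ [1, 1]"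

definition b4 :: "nat \<Rightarrow> bit list" where
  "b4 n = periodic_word [0, 1] n"

definition b5 :: "nat \<Rightarrow> bit list" where
  "b5 n = [1, 1] @ periodic_word [0] (n - 2)"

definition b6 :: "nat \<Rightarrow> bit list" where
  "b6 n = periodic_word [0] (n - 2) @ [1, 0]"

end

theory Submission
  imports Defs
begin

text \<open>
  Induction from \<open>n - 2\<close> to \<open>n\<close>, removing the first two rows of the triangle. These rows together
  carry at least 3 ones unless \<open>x\<close> is \<open>0\<dots>0\<close>, \<open>10\<dots>0\<close> or \<open>0\<dots>01\<close>, and exactly 3 only if \<open>x\<close> has
  a single one, in the interior, or is \<open>110\<dots>0\<close> or \<open>0\<dots>011\<close>; since the claimed value grows by
  exactly 3, the equality cases propagate. It remains to treat the \<open>x\<close> whose second derivative has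
  one of the two smallest weights: a zero second derivative leaves only the alternating words, and
  otherwise the first two rows are too heavy. The cases \<open>n = 6\<close> and \<open>n = 7\<close> are finite checks.
\<close>

section \<open>Derivatives, ones and the row recursion of the weight\<close>

abbreviation weight :: "bit list \<Rightarrow> nat" where
  "weight x \<equiv> triangle_weight (steinhaus_triangle x)"

lemma derivative_Nil [simp]: "derivative [] = []"
  by (simp add: derivative_def)

lemma derivative_single [simp]: "derivative [a] = []"
  by (simp add: derivative_def)

lemma derivative_Cons [simp]: "derivative (a # b # xs) = (a + b) # derivative (b # xs)"
proof -
  have "[0..<Suc (length xs)] = 0 # map Suc [0..<length xs]"
    by (metis map_Suc_upt upt_conv_Cons zero_less_Suc)
  then show ?thesis
    by (simp add: derivative_def del: upt_Suc)
qed

lemma length_derivative [simp]: "length (derivative x) = length x - 1"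
  by (simp add: derivative_def)

lemma ones_Nil [simp]: "ones [] = 0"
  by (simp add: ones_def)

lemma ones_Cons [simp]: "ones (a # xs) = (if a = 1 then Suc (ones xs) else ones xs)"
  by (simp add: ones_def)

lemma ones_append [simp]: "ones (xs @ ys) = ones xs + ones ys"
  by (simp add: ones_def)

lemma ones_replicate [simp]: "ones (replicate k c) = (if c = 1 then k else 0)"
  by (induction k) auto

lemma weight_Nil [simp]: "weight [] = 0"
  by (simp add: triangle_weight_def steinhaus_triangle_def)

text \<open>Deleting the first row of a Steinhaus triangle leaves the triangle of the
  derivative.\<close>

lemma weight_Cons: "weight (a # x) = ones (a # x) + weight (derivative (a # x))"
proof -
  have "[0..<Suc (length x)] = 0 # map Suc [0..<length x]"
    by (metis map_Suc_upt upt_conv_Cons zero_less_Suc)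
  then show ?thesis
    by (simp add: triangle_weight_def steinhaus_triangle_def funpow_swap1 comp_def
        del: upt_Suc funpow.simps ones_Cons add: funpow_Suc_right)
qed

lemma weight_eq: "x \<noteq> [] \<Longrightarrow> weight x = ones x + weight (derivative x)"
  by (cases x) (simp_all add: weight_Cons del: ones_Cons)

lemma weight_eq2:
  "2 \<le> length x \<Longrightarrow>
    weight x = ones x + ones (derivative x) + weight (derivative (derivative x))"
  using weight_eq[of x] weight_eq[of "derivative x"]
  by (cases x; cases "derivative x") (auto dest: arg_cong[of _ _ length])

lemma derivative_replicate [simp]: "derivative (replicate k c) = replicate (k - 1) 0"
proof (induction k)
  case (Suc k)
  then show ?case by (cases k) auto
qed simp

lemma derivative_zero_zeros [simp]: "derivative (0 # replicate k 0) = replicate k 0"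
  using derivative_replicate[of "Suc k" 0] by simp

lemma derivative_one_zeros [simp]:
  "derivative (1 # replicate k 0) = (if k = 0 then [] else 1 # replicate (k - 1) 0)"
  by (cases k) auto

lemma derivative_zeros_append [simp]:
  "derivative (replicate a 0 @ 1 # xs) =
    (if a = 0 then derivative (1 # xs) else replicate (a - 1) 0 @ 1 # derivative (1 # xs))"
proof (induction a)
  case (Suc a)
  then show ?case by (cases a) auto
qed simp

section \<open>Antiderivatives and the alternating words\<close>

lemma derivative_eq_zeros:
  assumes "derivative x = replicate k 0" "length x = Suc k"
  shows "x = replicate (Suc k) 0 \<or> x = replicate (Suc k) 1"
  using assms
proof (induction k arbitrary: x)
  case 0
  then show ?case by (cases x) auto
next
  case (Suc k)
  then obtain a b xs where "x = a # b # xs"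
    by (metis Suc_length_conv)
  with Suc show ?case by (cases a; cases b) fastforce+
qed

text \<open>Alternating words become mutually recursive, so the two can be treated by a simultaneous
  structural induction instead of through indices mod 2.\<close>

lemma b1_Suc: "b1 (Suc n) = 1 # b4 n" and b4_Suc: "b4 (Suc n) = 0 # b1 n"
  and b1_0 [simp]: "b1 0 = []" and b4_0 [simp]: "b4 0 = []"
proof -
  have *: "i mod Suc (Suc 0) = (if even i then 0 else 1)" for i
    by (simp add: mod2_eq_if flip: numeral_2_eq_2)
  have b1: "b1 k = map (\<lambda>i. if even i then 1 else 0) [0..<k]" for k
    by (simp add: b1_def periodic_word_def *)
  have b4: "b4 k = map (\<lambda>i. if even i then 0 else 1) [0..<k]" for k
    by (simp add: b4_def periodic_word_def *)
  have "[0..<Suc n] = 0 # map Suc [0..<n]"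
    by (metis map_Suc_upt upt_conv_Cons zero_less_Suc)
  then show "b1 (Suc n) = 1 # b4 n" "b4 (Suc n) = 0 # b1 n"
    by (simp_all add: b1 b4 del: upt_Suc)
  show "b1 0 = []" "b4 0 = []"
    by (simp_all add: b1 b4)
qed

lemma b_eq:
  "b2 n = [0, 1] @ replicate (n - 2) 0" "b3 n = replicate (n - 2) 0 @ [1, 1]"
  "b5 n = [1, 1] @ replicate (n - 2) 0" "b6 n = replicate (n - 2) 0 @ [1, 0]"
  by (simp_all add: b2_def b3_def b5_def b6_def periodic_word_def map_replicate_const)

text \<open>The first letter and the derivative determine a word, so every word has exactly two
  antiderivatives, complements of each other. Here they are the two alternating words.\<close>

lemma derivative_eq_ones:
  assumes "derivative x = replicate k 1" "length x = Suc k"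
  shows "x = b1 (Suc k) \<or> x = b4 (Suc k)"
  using assms
proof (induction k arbitrary: x)
  case 0
  then show ?case by (cases x) (auto simp: b1_Suc b4_Suc)
next
  case (Suc k)
  then obtain a b xs where "x = a # b # xs"
    by (metis Suc_length_conv)
  with Suc show ?case by (cases a; cases b) (fastforce simp: b1_Suc b4_Suc)+
qed

lemma derivative_b1_b4:
  "derivative (b1 n) = replicate (n - 1) 1" "derivative (b4 n) = replicate (n - 1) 1"
proof (induction n)
  case (Suc n)
  {
    case 1 show ?case using Suc by (cases n) (auto simp: b1_Suc b4_Suc)
  next
    case 2 show ?case using Suc by (cases n) (auto simp: b1_Suc b4_Suc)
  }
qed simp_all

lemma ones_b1_b4: "ones (b1 n) = (n + 1) div 2" "ones (b4 n) = n div 2"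
  by (induction n) (auto simp: b1_Suc b4_Suc)

lemma length_b1_b4 [simp]: "length (b1 n) = n" "length (b4 n) = n"
  by (simp_all add: b1_def b4_def periodic_word_def)

lemma derivative_eq_one_zeros:
  assumes "derivative x = 1 # replicate k 0" "length x = k + 2"
  shows "x = 1 # replicate (Suc k) 0 \<or> x = 0 # replicate (Suc k) 1"
proof -
  obtain a b xs where x: "x = a # b # xs"
    using assms(2) by (metis Suc_length_conv add_2_eq_Suc')
  with assms derivative_eq_zeros[of "b # xs" k] show ?thesis
    by (cases a; cases b) auto
qed

lemma derivative_eq_zeros_one:
  assumes "derivative x = replicate k 0 @ [1]" "length x = k + 2"
  shows "x = replicate (Suc k) 0 @ [1] \<or> x = replicate (Suc k) 1 @ [0]"
  using assms
proof (induction k arbitrary: x)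
  case 0
  then obtain a b where "x = [a, b]"
    by (auto simp: length_Suc_conv numeral_2_eq_2)
  with 0 show ?case by (cases a; cases b) auto
next
  case (Suc k)
  then obtain a b xs where "x = a # b # xs"
    by (metis Suc_length_conv add_2_eq_Suc')
  with Suc show ?case by (cases a; cases b) fastforce+
qed

text \<open>Entry i of the second derivative is x_i + x_{i+2}, so here letters two apart are
  complementary and any four consecutive letters contain exactly two ones. The induction strips four
  letters at a time; the summand 2 absorbs the remainder.\<close>

lemma length_le_ones:
  assumes "derivative (derivative x) = replicate k 1" "length x = k + 2"
  shows "length x \<le> 2 * ones x + 2"
  using assms
proof (induction k arbitrary: x rule: less_induct)
  case (less k)
  consider "k = 0" | "k = 1" | "k \<ge> 2"
    by linarith
  then show ?case
  proof cases
    case 1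
    with less.prems show ?thesis by simp
  next
    case 2
    with less.prems obtain a b c where "x = [a, b, c]"
      by (auto simp: length_Suc_conv numeral_3_eq_3)
    with less.prems 2 show ?thesis by (cases a; cases b; cases c) auto
  next
    case 3
    then obtain m where k: "k = Suc (Suc m)"
      by (metis add_2_eq_Suc le_Suc_ex)
    with less.prems(2) obtain a b c d ys where x: "x = a # b # c # d # ys"
      by (auto simp: length_Suc_conv)
    have "ones x = 2 + ones ys"
      using less.prems x k by (cases a; cases b; cases c; cases d) auto
    moreover have "length ys \<le> 2 * ones ys + 2"
    proof (cases "m < 2")
      \<comment> \<open>\<open>ys\<close> has length \<open>m\<close>, at most 1, too short for the
        induction hypothesis; the slack 2 suffices.\<close>
      case True
      with less.prems x k show ?thesis by simp
    next
      case False
      then obtain l where m: "m = Suc (Suc l)"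
        by (metis add_2_eq_Suc le_Suc_ex not_less)
      with less.prems x k obtain e f zs where "ys = e # f # zs"
        by (auto simp: length_Suc_conv)
      with less.prems x k m less.IH[of l ys] show ?thesis by simp
    qed
    ultimately show ?thesis using x by simp
  qed
qed

section \<open>Words with few ones in the first two rows\<close>

text \<open>Dropping the first letter increases neither count, so the tail is already on the list;
  it remains to see which letters may be put in front.\<close>

lemma ones_derivative_le_3:
  assumes "ones x + ones (derivative x) \<le> 3"
  shows "(\<exists>k. x = replicate k 0) \<or> (\<exists>a b. x = replicate a 0 @ 1 # replicate b 0) \<or>
    (\<exists>b. x = 1 # 1 # replicate b 0) \<or> (\<exists>a. x = replicate a 0 @ [1, 1]) \<or> x = [1, 1, 1]"
    (is "?Q x")
  using assms
proof (induction x)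
  case Nil
  then show ?case by simp
next
  case (Cons c y)
  show ?case
  proof (cases y)
    case Nil
    \<comment> \<open>Two readings of a one-letter word: the first serves \<open>c = 1\<close>, the
      second \<open>c = 0\<close>.\<close>
    then have "c # y = replicate 0 0 @ c # replicate 0 0" "c # y = replicate 1 c"
      by simp_all
    then show ?thesis by (cases c) metis+
  next
    case y: (Cons d ys)
    with Cons consider (zeros) k where "y = replicate k 0"
      | (one) a b where "y = replicate a 0 @ 1 # replicate b 0"
      | (left) b where "y = 1 # 1 # replicate b 0"
      | (right) a where "y = replicate a 0 @ [1, 1]" | (three) "y = [1, 1, 1]"
      by (auto split: if_splits)
    then show ?thesis
    proof cases
      case zeros
      then have "c # y = replicate (Suc k) 0 \<or> c # y = replicate 0 0 @ 1 # replicate k 0"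
        by (cases c) auto
      then show ?thesis by blast
    next
      case one
      show ?thesis
      proof (cases c)
        case zero
        with one have "c # y = replicate (Suc a) 0 @ 1 # replicate b 0"
          by simp
        then show ?thesis by blast
      next
        case one': one
        \<comment> \<open>If \<open>a > 0\<close>, then \<open>c # y\<close> has two ones and its
          derivative has one in front and at least one more, which makes 4.\<close>
        have "1 \<le> ones (derivative (replicate a 0 @ 1 # replicate b 0))" if "0 < a"
          using that by simp
        then have "a = 0"
          using Cons.prems one one' by (cases a) auto
        then show ?thesis using one one' by auto
      qed
    next
      case left
      then show ?thesis
        \<comment> \<open>Only \<open>b = 0\<close> survives, giving 011, which is of the form
          0...011, and 111.\<close>
        using Cons.prems by (cases c; cases b) (auto intro: exI[of _ "Suc 0"] exI[of _ "0::nat"])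
    next
      case right
      show ?thesis
      proof (cases c)
        case zero
        with right have "c # y = replicate (Suc a) 0 @ [1, 1]"
          by simp
        then show ?thesis by blast
      next
        case one
        with right Cons.prems show ?thesis by (cases a; cases "a - 1") auto
      qed
    next
      case three
      with Cons.prems show ?thesis by (cases c) auto
    qed
  qed
qed

text \<open>The words of weight \<open>w\<^sub>0 = 0\<close> or \<open>w\<^sub>1 = n\<close>.\<close>

definition light :: "nat \<Rightarrow> bit list set" where
  "light n = {replicate n 0, 1 # replicate (n - 1) 0, replicate (n - 1) 0 @ [1], replicate n 1}"

text \<open>The claimed set \<open>W\<^sub>2\<close>.\<close>

definition second :: "nat \<Rightarrow> bit list set" where
  "second n = (if even n then {b1 n, b2 n, b3 n, b4 n, b5 n, b6 n} else {b2 n, b4 n, b6 n}) \<union>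
    (if n = 6 then {[0,0,1,0,0,0], [0,0,0,1,0,0], [0,0,1,1,0,0]}
     else if n = 7 then {[0,0,0,1,0,0,0]} else {})"

section \<open>Weights of the words in \<open>light\<close> and \<open>second\<close>\<close>

lemma weight_zeros [simp]: "weight (replicate n 0) = 0"
proof (induction n)
  case (Suc n)
  then show ?case using weight_eq[of "replicate (Suc n) 0"] by (simp del: replicate_Suc)
qed simp

lemma weight_ones [simp]: "weight (replicate n 1) = n"
  using weight_eq[of "replicate n 1"] by (cases "n = 0") simp_all

lemma weight_one_zeros [simp]: "weight (1 # replicate n 0) = n + 1"
proof (induction n)
  case (Suc n)
  then show ?case using weight_eq[of "1 # replicate (Suc n) 0"] by (simp del: replicate_Suc)
qed (simp add: weight_Cons)

lemma weight_zeros_one [simp]: "weight (replicate n 0 @ [1]) = n + 1"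
proof (induction n)
  case (Suc n)
  then show ?case using weight_eq[of "replicate (Suc n) 0 @ [1]"] by (simp del: replicate_Suc)
qed (simp add: weight_Cons)

lemma weight_b1_b4:
  assumes "0 < n"
  shows "weight (b1 n) = (n + 1) div 2 + (n - 1)" "weight (b4 n) = n div 2 + (n - 1)"
proof -
  have "b1 n \<noteq> []" "b4 n \<noteq> []"
    using assms by (auto simp: b1_def b4_def periodic_word_def)
  then show "weight (b1 n) = (n + 1) div 2 + (n - 1)" "weight (b4 n) = n div 2 + (n - 1)"
    by (simp_all add: weight_eq[of "b1 n"] weight_eq[of "b4 n"] derivative_b1_b4 ones_b1_b4)
qed

text \<open>For \<open>k\<close> at least 2, two derivatives turn the word into the same one with
  two zeros fewer, passing through 110...0; the two rows removed carry 1 + 2 ones.\<close>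

lemma weight_zero_one_zeros: "weight (0 # 1 # replicate k 0) = (3 * k + 4) div 2"
proof (induction k rule: less_induct)
  case (less k)
  consider "k = 0" | "k = 1" | l where "k = Suc (Suc l)"
    by (metis One_nat_def not0_implies_Suc)
  then show ?case
  proof cases
    case 3
    with less.IH[of l] show ?thesis
      using weight_eq2[of "0 # 1 # replicate k 0"] by simp
  qed (simp_all add: weight_Cons)
qed

lemma weight_one_one_zeros: "0 < k \<Longrightarrow> weight (1 # 1 # replicate k 0) = (3 * k + 5) div 2"
  using weight_Cons[of 1 "1 # replicate k 0"] weight_zero_one_zeros[of "k - 1"] by (cases k) simp_all

lemma weight_zeros_one_zero: "weight (replicate k 0 @ [1, 0]) = (3 * k + 4) div 2"
proof (induction k rule: less_induct)
  case (less k)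
  consider "k = 0" | "k = 1" | l where "k = Suc (Suc l)"
    by (metis One_nat_def not0_implies_Suc)
  then show ?case
  proof cases
    case 3
    with less.IH[of l] show ?thesis
      using weight_eq2[of "replicate k 0 @ [1, 0]"] by (simp del: replicate_Suc)
  qed (simp_all add: weight_Cons)
qed

lemma weight_zeros_one_one:
  assumes "0 < k"
  shows "weight (replicate k 0 @ [1, 1]) = (3 * k + 5) div 2"
  using assms weight_eq[of "replicate k 0 @ [1, 1]"] weight_zeros_one_zero[of "k - 1"]
  by (cases k) (simp_all del: replicate_Suc)

lemma light_6: "light 6 = {[0,0,0,0,0,0], [1,0,0,0,0,0], [0,0,0,0,0,1], [1,1,1,1,1,1]}"
  by (simp add: light_def eval_nat_numeral)

lemma light_7: "light 7 = {[0,0,0,0,0,0,0], [1,0,0,0,0,0,0], [0,0,0,0,0,0,1], [1,1,1,1,1,1,1]}"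
  by (simp add: light_def eval_nat_numeral)

lemma second_6: "second 6 = {[1,0,1,0,1,0], [0,1,0,0,0,0], [0,0,0,0,1,1], [0,1,0,1,0,1],
    [1,1,0,0,0,0], [0,0,0,0,1,0], [0,0,1,0,0,0], [0,0,0,1,0,0], [0,0,1,1,0,0]}"
proof -
  have "b1 6 = [1,0,1,0,1,0]" "b2 6 = [0,1,0,0,0,0]" "b3 6 = [0,0,0,0,1,1]"
    "b4 6 = [0,1,0,1,0,1]" "b5 6 = [1,1,0,0,0,0]" "b6 6 = [0,0,0,0,1,0]"
    by (simp_all add: b_eq b1_Suc b4_Suc eval_nat_numeral)
  then show ?thesis by (simp add: second_def insert_commute)
qed

lemma second_7: "second 7 = {[0,1,0,0,0,0,0], [0,1,0,1,0,1,0], [0,0,0,0,0,1,0], [0,0,0,1,0,0,0]}"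
proof -
  have "b2 7 = [0,1,0,0,0,0,0]" "b4 7 = [0,1,0,1,0,1,0]" "b6 7 = [0,0,0,0,0,1,0]"
    by (simp_all add: b_eq b1_Suc b4_Suc eval_nat_numeral)
  then show ?thesis by (simp add: second_def insert_commute)
qed

lemma weight_second:
  assumes "6 \<le> n" "x \<in> second n"
  shows "length x = n \<and> weight x = (3 * n - 2) div 2"
proof -
  \<comment> \<open>\<open>k\<close> is the length of the zero block in \<open>b2\<close>,
    \<open>b3\<close>, \<open>b5\<close> and \<open>b6\<close>.\<close>
  define k where "k = n - 2"
  have n: "n = k + 2" "0 < k"
    using assms(1) k_def by simp_all
  \<comment> \<open>Rounding decides membership: for odd \<open>n\<close> the weights of
    \<open>b1\<close>, \<open>b3\<close> and \<open>b5\<close> are one above the claimed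
    value.\<close>
  have half: "(3 * n - 2) div 2 = (3 * k + 4) div 2"
    "even n \<Longrightarrow> (3 * k + 5) div 2 = (3 * k + 4) div 2"
    "even n \<Longrightarrow> (n + 1) div 2 + (n - 1) = (3 * k + 4) div 2"
    "n div 2 + (n - 1) = (3 * k + 4) div 2"
    unfolding n by presburger+
  consider (base) "n = 6" "x \<in> {[0,0,1,0,0,0], [0,0,0,1,0,0], [0,0,1,1,0,0]}"
    | (base') "n = 7" "x = [0,0,0,1,0,0,0]"
    | (b1) "even n" "x = b1 n" | (b2) "x = b2 n" | (b3) "even n" "x = b3 n"
    | (b4) "x = b4 n" | (b5) "even n" "x = b5 n" | (b6) "x = b6 n"
    using assms(2) by (auto simp: second_def split: if_splits)
  then show ?thesis
  proof cases
    case base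
    then show ?thesis by (auto simp: weight_Cons)
  next
    case base'
    then show ?thesis by (simp add: weight_Cons)
  next
    case b1
    then show ?thesis using weight_b1_b4(1)[of n] half n by simp
  next
    case b2
    then show ?thesis using weight_zero_one_zeros[of k] half n by (simp add: b_eq)
  next
    case b3
    then show ?thesis using weight_zeros_one_one[of k] half n by (simp add: b_eq)
  next
    case b4
    then show ?thesis using weight_b1_b4(2)[of n] half n by simp
  next
    case b5
    then show ?thesis using weight_one_one_zeros[of k] half n by (simp add: b_eq)
  next
    case b6
    then show ?thesis using weight_zeros_one_zero[of k] half n by (simp add: b_eq)
  qed
qed

section \<open>Lower bound: base cases\<close>

text \<open>The induction has step two, so each parity needs its own base case; these check all 64
  and all 128 words.\<close>

lemma weight_lower_6:
  assumes "length x = 6" "x \<notin> light 6"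
  shows "8 \<le> weight x \<and> (weight x = 8 \<longrightarrow> x \<in> second 6)"
proof -
  obtain a b c d e f where "x = [a, b, c, d, e, f]"
    using assms(1) by (auto simp: eval_nat_numeral length_Suc_conv)
  then show ?thesis
    using assms(2) unfolding light_6 second_6
    by (cases a; cases b; cases c; cases d; cases e; cases f) (simp_all add: weight_Cons)
qed

lemma weight_lower_7:
  assumes "length x = 7" "x \<notin> light 7"
  shows "9 \<le> weight x \<and> (weight x = 9 \<longrightarrow> x \<in> second 7)"
proof -
  obtain a b c d e f g where "x = [a, b, c, d, e, f, g]"
    using assms(1) by (auto simp: eval_nat_numeral length_Suc_conv)
  then show ?thesis
    using assms(2) unfolding light_7 second_7
    by (cases a; cases b; cases c; cases d; cases e; cases f; cases g) (simp_all add: weight_Cons)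
qed

section \<open>Lower bound: inductive step\<close>

lemma ones_derivative_ge_3:
  assumes "6 \<le> n" "length x = n" "x \<notin> light n"
  shows "3 \<le> ones x + ones (derivative x) \<and> (ones x + ones (derivative x) = 3 \<longrightarrow>
    (\<exists>a b. x = replicate (Suc a) 0 @ 1 # replicate (Suc b) 0) \<or> x = b3 n \<or> x = b5 n)"
proof (cases "ones x + ones (derivative x) \<le> 3")
  case True
  then consider (zeros) k where "x = replicate k 0"
    | (one) a b where "x = replicate a 0 @ 1 # replicate b 0"
    | (left) b where "x = 1 # 1 # replicate b 0"
    | (right) a where "x = replicate a 0 @ [1, 1]" | (three) "x = [1, 1, 1]"
    using ones_derivative_le_3 by blast
  then show ?thesis
  proof cases
    case zeros
    with assms show ?thesis by (simp add: light_def)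
  next
    case one
    with assms obtain a' b' where ab: "a = Suc a'" "b = Suc b'"
      by (cases a; cases b) (auto simp: light_def)
    with one have "x = replicate (Suc a') 0 @ 1 # replicate (Suc b') 0"
      by simp
    moreover from this have "ones x + ones (derivative x) = 3"
      by (simp only: derivative_zeros_append ones_append ones_replicate) simp
    ultimately show ?thesis by (metis order_refl)
  next
    case left
    with assms show ?thesis by (auto simp: b_eq)
  next
    case right
    with assms show ?thesis by (auto simp: b_eq)
  next
    case three
    with assms show ?thesis by simp
  qed
qed simp

text \<open>Integrating the second derivative back twice leaves few candidates for \<open>x\<close>.
  A nonzero light second derivative weighs \<open>n - 2\<close>, so it is enough that the first two
  rows carry more than \<open>n div 2 + 1\<close> ones; this is where \<open>n\<close> at least 8
  enters.\<close>

lemma weight_light_derivative: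
  assumes n: "8 \<le> n" "length x = n" "x \<notin> light n"
    and light: "derivative (derivative x) \<in> light (n - 2)"
  shows "x = b1 n \<or> x = b4 n \<or> (3 * n - 2) div 2 < weight x"
proof -
  define y where "y = derivative (derivative x)"
  have w: "weight x = ones x + ones (derivative x) + weight y"
    using weight_eq2 n y_def by simp
  \<comment> \<open>The second derivative has length \<open>k + 1\<close>.\<close>
  obtain k where k: "n = k + 3"
    using n that[of "n - 3"] by simp
  consider (zeros) "y = replicate (Suc k) 0" | (left) "y = 1 # replicate k 0"
    | (right) "y = replicate k 0 @ [1]" | (ones) "y = replicate (Suc k) 1"
    using light k y_def by (auto simp: light_def)
  then show ?thesis
  proof cases
    case zeros
    \<comment> \<open>A zero derivative would make \<open>x\<close> constant, hence light; an
      all-ones derivative makes it alternating.\<close>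
    then have "derivative x = replicate (k + 2) 0 \<or> derivative x = replicate (k + 2) 1"
      using derivative_eq_zeros[of "derivative x" "Suc k"] y_def n k by simp
    moreover have "length x = Suc (k + 2)" "n = Suc (k + 2)"
      using n k by simp_all
    ultimately show ?thesis
      using derivative_eq_zeros[of x "k + 2"] derivative_eq_ones[of x "k + 2"] n(3)
      unfolding light_def by blast
  next
    case left
    then have "derivative x = 1 # replicate (Suc k) 0 \<or> derivative x = 0 # replicate (Suc k) 1"
      using derivative_eq_one_zeros[of "derivative x" k] y_def n k by simp
    then show ?thesis
    proof
      assume "derivative x = 1 # replicate (Suc k) 0"
      \<comment> \<open>The other antiderivative, 10...0, is light and thus excluded.\<close>
      with n k derivative_eq_one_zeros[of x "Suc k"] have "x = 0 # replicate (k + 2) 1"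
        by (simp add: light_def)
      then have "ones x = k + 2" by simp
      moreover have "weight y = k + 1" using left by simp
      ultimately show ?thesis using w n k by linarith
    next
      assume "derivative x = 0 # replicate (Suc k) 1"
      \<comment> \<open>The second row alone is heavy enough.\<close>
      then have "ones (derivative x) = k + 1" by simp
      moreover have "weight y = k + 1" using left by simp
      ultimately show ?thesis using w n k by linarith
    qed
  next
    case right
    then have "derivative x = replicate (Suc k) 0 @ [1] \<or> derivative x = replicate (Suc k) 1 @ [0]"
      using derivative_eq_zeros_one[of "derivative x" k] y_def n k by simp
    then show ?thesis
    proof
      assume "derivative x = replicate (Suc k) 0 @ [1]"
      with n k derivative_eq_zeros_one[of x "Suc k"] have "x = replicate (k + 2) 1 @ [0]"
        by (simp add: light_def)
      then have "ones x = k + 2" by simp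
      moreover have "weight y = k + 1" using right by simp
      ultimately show ?thesis using w n k by linarith
    next
      assume "derivative x = replicate (Suc k) 1 @ [0]"
      then have "ones (derivative x) = k + 1" by simp
      moreover have "weight y = k + 1" using right by simp
      ultimately show ?thesis using w n k by linarith
    qed
  next
    case ones
    then have "derivative x = b1 (k + 2) \<or> derivative x = b4 (k + 2)"
      using derivative_eq_ones[of "derivative x" "Suc k"] y_def n k by simp
    then have "(k + 2) div 2 \<le> ones (derivative x)"
      by (elim disjE) (simp_all add: ones_b1_b4)
    moreover have "n \<le> 2 * ones x + 2"
      using length_le_ones[of x "Suc k"] ones y_def n k by simp
    moreover have "weight y = Suc k"
      using ones by (metis weight_ones)
    ultimately show ?thesis using w n k by linarith
  qed
qed

text \<open>The pair of counts separates them: this word has two ones and its derivative at least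
  three, while the only words of \<open>second\<close> with two ones, \<open>b3\<close>,
  \<open>b5\<close> and 001100, have at most two in the derivative.\<close>

lemma one_zero_one_notin_second:
  assumes "6 \<le> n"
  shows "replicate a 0 @ 1 # 0 # 1 # replicate b 0 \<notin> second n" (is "?y \<notin> _")
proof
  assume y: "?y \<in> second n"
  with assms weight_second have n: "n = a + b + 3"
    by fastforce
  have "3 \<le> ones (derivative ?y)"
    using assms n by (cases b) auto
  moreover have "ones ?y = 2" by simp
  moreover have "ones z \<noteq> 2 \<or> ones (derivative z) \<le> 2" if "z \<in> second n" for z
    using that assms by (auto simp: second_def b_eq ones_b1_b4 split: if_splits)
  ultimately show False
    using y by fastforce
qed

text \<open>Bound and equality case are proved together, since equality for \<open>x\<close> forces
  equality for its second derivative, whose membership in \<open>second (n - 2)\<close> is then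
  needed.\<close>

lemma weight_lower:
  assumes "6 \<le> n" "length x = n" "x \<notin> light n"
  shows "(3 * n - 2) div 2 \<le> weight x \<and> (weight x = (3 * n - 2) div 2 \<longrightarrow> x \<in> second n)"
  using assms
proof (induction n arbitrary: x rule: less_induct)
  case (less n)
  consider "n = 6" | "n = 7" | "8 \<le> n"
    using less.prems(1) by linarith
  then show ?case
  proof cases
    case 1
    with less.prems weight_lower_6 show ?thesis by simp
  next
    case 2
    with less.prems weight_lower_7 show ?thesis by simp
  next
    case 3
    define y where "y = derivative (derivative x)"
    have w: "weight x = ones x + ones (derivative x) + weight y"
      using weight_eq2 3 less.prems y_def by simp
    show ?thesis
    proof (cases "y \<in> light (n - 2)")
      case True
      with 3 less.prems y_def consider "x = b1 n" | "x = b4 n" | "(3 * n - 2) div 2 < weight x"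
        using weight_light_derivative by blast
      then show ?thesis
      proof cases
        case 1
        \<comment> \<open>For odd \<open>n\<close> the bound is strict for \<open>b1 n\<close>, so
          membership is at stake only for even \<open>n\<close>.\<close>
        with 3 show ?thesis by (auto simp: weight_b1_b4 second_def)
      next
        case 2
        with 3 show ?thesis by (auto simp: weight_b1_b4 second_def)
      qed simp
    next
      case False
      with 3 less.prems y_def less.IH[of "n - 2" y]
      have y: "(3 * (n - 2) - 2) div 2 \<le> weight y"
        "weight y = (3 * (n - 2) - 2) div 2 \<Longrightarrow> y \<in> second (n - 2)"
        by simp_all
      have half: "(3 * n - 2) div 2 = 3 + (3 * (n - 2) - 2) div 2"
        using 3 by presburger
      have r: "3 \<le> ones x + ones (derivative x)"
        "ones x + ones (derivative x) = 3 \<Longrightarrow>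
          (\<exists>a b. x = replicate (Suc a) 0 @ 1 # replicate (Suc b) 0) \<or> x = b3 n \<or> x = b5 n"
        using ones_derivative_ge_3[OF less.prems] by blast+
      have "x \<in> second n" if eq: "weight x = (3 * n - 2) div 2"
      proof -
        have "ones x + ones (derivative x) = 3" and y2: "y \<in> second (n - 2)"
          using w half eq y r(1) by linarith+
        then consider (one) a b where "x = replicate (Suc a) 0 @ 1 # replicate (Suc b) 0"
          | (b3) "x = b3 n" | (b5) "x = b5 n"
          using r(2) by blast
        then show ?thesis
        proof cases
          case one
          \<comment> \<open>With two zeros on each side of the one, the second derivative would be
            0...01010...0 with 101 in the middle, which is not in \<open>second (n - 2)\<close>. So
            the one is next to an end letter, giving \<open>b2\<close> or \<open>b6\<close>.\<close>
          have "a = 0 \<or> b = 0"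
          proof (rule ccontr)
            assume "\<not> ?thesis"
            then obtain a' b' where "a = Suc a'" "b = Suc b'"
              by (metis not0_implies_Suc)
            then have "y = replicate a' 0 @ 1 # 0 # 1 # replicate b' 0"
              unfolding y_def one by (simp del: replicate_Suc)
            with one_zero_one_notin_second[of "n - 2" a' b'] y2 3 show False by simp
          qed
          moreover have "n - 2 = Suc (a + b)"
            using one less.prems by simp
          ultimately have "x = b2 n \<or> x = b6 n"
            using one by (auto simp: b_eq)
          then show ?thesis by (auto simp: second_def)
        next
          case b3
          \<comment> \<open>The weight is \<open>(3 * n - 1) div 2\<close>, which equals the bound
            only for even \<open>n\<close>.\<close>
          then have "even n"
            using eq 3 weight_zeros_one_one[of "n - 2"] by (simp add: b_eq) presburger
          with b3 show ?thesis by (simp add: second_def)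
        next
          case b5
          then have "even n"
            using eq 3 weight_one_one_zeros[of "n - 2"] by (simp add: b_eq) presburger
          with b5 show ?thesis by (simp add: second_def)
        qed
      qed
      moreover have "(3 * n - 2) div 2 \<le> weight x"
        using w half y(1) r(1) by linarith
      ultimately show ?thesis by blast
    qed
  qed
qed

section \<open>Reading off the third smallest weight\<close>

lemma sorted_list_of_set_least:
  fixes a :: "'a :: linorder"
  assumes "finite A" "\<And>b. b \<in> A \<Longrightarrow> a < b"
  shows "sorted_list_of_set (insert a A) = a # sorted_list_of_set A"
proof -
  have "Min (insert a A) = a"
    using assms by (intro Min_eqI) (auto intro: less_imp_le)
  moreover have "insert a A - {a} = A"
    using assms by auto
  ultimately show ?thesis
    using sorted_list_of_set_nonempty[of "insert a A"] assms(1) by simp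
qed

theorem theorem5p6:
  fixes n :: nat
  assumes "n \<ge> 6"
  shows "2 < card (weights n) \<and> w n 2 = (3 * n - 2) div 2 \<and>
    (n = 6 \<longrightarrow> W n 2 = {b1 n, b2 n, b3 n, b4 n, b5 n, b6 n,
        [0,0,1,0,0,0], [0,0,0,1,0,0], [0,0,1,1,0,0]}) \<and>
    (n = 7 \<longrightarrow> W n 2 = {b2 n, b4 n, b6 n, [0,0,0,1,0,0,0]}) \<and>
    (n \<ge> 8 \<and> even n \<longrightarrow> W n 2 = {b1 n, b2 n, b3 n, b4 n, b5 n, b6 n}) \<and>
    (n \<ge> 9 \<and> odd n \<longrightarrow> W n 2 = {b2 n, b4 n, b6 n})"
proof -
  define m where "m = (3 * n - 2) div 2"
  \<comment> \<open>\<open>R\<close> collects the weights beyond the three smallest.\<close>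
  define R where "R = {v \<in> weights n. m < v}"
  have "n < m"
    using assms m_def by presburger
  have fin: "finite (weights n)"
  proof -
    have "finite (UNIV :: bit set)"
      by (rule finite_subset[of _ "{0, 1}"]) (auto intro: bit.exhaust)
    then show ?thesis
      using finite_lists_length_eq[of "UNIV :: bit set" n]
      by (simp add: weights_def sequences_def)
  qed
  have light: "length x = n \<and> weight x \<in> {0, n}" if "x \<in> light n" for x
    using that assms by (auto simp: light_def)
  have second: "length x = n \<and> weight x = m" if "x \<in> second n" for x
    using weight_second assms that m_def by blast
  have lower: "m \<le> weight x \<and> (weight x = m \<longrightarrow> x \<in> second n)"
    if "length x = n" "x \<notin> light n" for x
    using weight_lower[OF assms that] m_def by simp
  have weights_mem: "weight x \<in> weights n" if "length x = n" for x
    using that by (simp add: weights_def sequences_def)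
  \<comment> \<open>\<open>b4 n\<close> lies in \<open>second n\<close> for either parity, so it
    witnesses the weight \<open>m\<close>.\<close>
  have mem: "m \<in> weights n" "0 \<in> weights n" "n \<in> weights n"
    using weights_mem[of "b4 n"] weights_mem[of "replicate n 0"] weights_mem[of "replicate n 1"]
      second[of "b4 n"]
    by (simp_all add: second_def)
  have "v \<in> {0, n, m} \<or> m < v" if "v \<in> weights n" for v
    using that light lower by (fastforce simp: weights_def sequences_def)
  with mem have weights: "weights n = insert 0 (insert n (insert m R))"
    by (auto simp: R_def)
  have "sorted_list_of_set (weights n) = 0 # n # m # sorted_list_of_set R"
    \<comment> \<open>Since 0 < \<open>n\<close> < \<open>m\<close> and \<open>m\<close> lies below
      all of \<open>R\<close>, the least element can be peeled off three times.\<close>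
    using fin \<open>n < m\<close> assms unfolding weights
    by (subst sorted_list_of_set_least, force simp: R_def, force simp: R_def)+ simp
  moreover from this have "2 < card (weights n)"
    using length_sorted_list_of_set[of "weights n"] by simp
  ultimately have w: "w n 2 = m" "2 < card (weights n)"
    by (simp_all add: w_def)
  have "W n 2 = second n"
  proof
    show "second n \<subseteq> W n 2"
      using second by (auto simp: W_def sequences_def w)
    show "W n 2 \<subseteq> second n"
    proof
      fix x
      assume "x \<in> W n 2"
      then have x: "length x = n" "weight x = m"
        by (simp_all add: W_def sequences_def w)
      \<comment> \<open>Light words weigh 0 or \<open>n\<close>, both less than
        \<open>m\<close>.\<close>
      with light[of x] \<open>n < m\<close> have "x \<notin> light n" by auto
      with x lower show "x \<in> second n" by blast
    qed
  qed
  show ?thesis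
    using w unfolding \<open>W n 2 = second n\<close> by (simp add: second_def m_def insert_commute)
qed

end
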